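(* Let $k\ge2$. For $n\ge0$ let $ud(n)$, $dd(n)$, $uu(n)$, $du(n)$ be, respectively, the numbers of up-down, down-down, up-up and down-up permutations of length $n$ that avoid $1\mbox{-}3\mbox{-}2$ and contain the pattern $1\mbox{-}2\mbox{-}\cdots\mbox{-}k$ exactly once, with generating functions $UD(x)=\sum_n ud(n)x^n$, $DD(x)=\sum_n dd(n)x^n$, $UU(x)=\sum_n uu(n)x^n$, $DU(x)=\sum_n du(n)x^n$. Writing $U_r$ for $U_r\!\left(\frac1{2x}\right)$, (1) $UD(x)=\dfrac{x}{U_{k-1}^2}$; (2) $DD(x)=\dfrac{1}{U_{k-1}}\displaystyle\sum_{m=0}^{k-2}\frac{x^{k-1-m}\bigl(x^{m+1}+U_{m-1}\bigr)}{U_mU_{m+1}}$; (3) $UU(x)=\dfrac{1}{U_{k-1}^2}$; (4) $DU(x)=\dfrac{1}{xU_{k-1}}\displaystyle\sum_{m=0}^{k-2}\frac{x^{k-1-m}\bigl(x^{m+1}+U_{m-1}\bigr)}{U_mU_{m+1}}$.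
   Context: A permutation of length $n$ is a word $\pi_1\cdots\pi_n$ containing each of $1,\dots,n$ exactly once. A classical pattern $\tau$ of length $m$ (written with dashes) occurs in $\pi$ at indices $i_1<\dots<i_m$ if $\pi_{i_1}\cdots\pi_{i_m}$ is order-isomorphic to $\tau$; $\pi$ contains $\tau$ exactly $r$ times if there are exactly $r$ such index tuples, and avoids $\tau$ if $r=0$. $1\mbox{-}3\mbox{-}2$ is the pattern $132$; $1\mbox{-}2\mbox{-}\cdots\mbox{-}k$ is an increasing subsequence of length $k$. For $n\ge2$: up-down permutations satisfy $\pi_1<\pi_2>\pi_3<\cdots$ with $n$ odd; up-up ones satisfy $\pi_1<\pi_2>\pi_3<\cdots$ with $n$ even; down-up ones satisfy $\pi_1>\pi_2<\pi_3>\cdots$ with $n$ odd; down-down ones satisfy $\pi_1>\pi_2<\pi_3>\cdots$ with $n$ even. For $n=0,1$ these classes are empty. $U_r$ is the Chebyshev polynomial of the second kind, $U_r(\cos\theta)=\sin((r+1)\theta)/\sin\theta$; $U_{-1}=0$, $U_0=1$, $U_1(t)=2t$, $U_r(t)=2tU_{r-1}(t)-U_{r-2}(t)$. *)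

theory Defs
  imports
    Complex_Main
    "HOL-Computational_Algebra.Computational_Algebra"
    "HOL-Combinatorics.Multiset_Permutations"
begin

text \<open>
  A permutation of length \<open>n\<close> is an element of \<^term>\<open>permutations_of_set {1..n}\<close>, i.e. a list
  containing each of \<open>1, \<dots>, n\<close> exactly once. List positions are counted from 0, so the letter
  \<open>\<pi>\<^sub>i\<close> of the word is \<^term>\<open>\<pi> ! (i - 1)\<close>.
\<close>

definition order_isomorphic :: "nat list \<Rightarrow> nat list \<Rightarrow> bool" where
  "order_isomorphic u v \<longleftrightarrow>
     length u = length v \<and>
     (\<forall>i<length u. \<forall>j<length u. u ! i < u ! j \<longleftrightarrow> v ! i < v ! j)"

definition occurrences :: "nat list \<Rightarrow> nat list \<Rightarrow> nat list set" where
  "occurrences \<tau> \<pi> =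
     {is. length is = length \<tau> \<and> sorted_wrt (<) is \<and> set is \<subseteq> {..<length \<pi>} \<and>
          order_isomorphic (map (\<lambda>i. \<pi> ! i) is) \<tau>}"

lemma finite_occurrences: "finite (occurrences \<tau> \<pi>)"
proof (rule finite_subset)
  show "occurrences \<tau> \<pi> \<subseteq> {is. set is \<subseteq> {..<length \<pi>} \<and> length is = length \<tau>}"
    by (auto simp: occurrences_def)
qed (simp add: finite_lists_length_eq)

definition contains_exactly :: "nat \<Rightarrow> nat list \<Rightarrow> nat list \<Rightarrow> bool" where
  "contains_exactly r \<tau> \<pi> \<longleftrightarrow> card (occurrences \<tau> \<pi>) = r"

definition avoids :: "nat list \<Rightarrow> nat list \<Rightarrow> bool" where
  "avoids \<tau> \<pi> \<longleftrightarrow> contains_exactly 0 \<tau> \<pi>"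

definition alternating_from_up :: "nat list \<Rightarrow> bool" where
  "alternating_from_up \<pi> \<longleftrightarrow>
     (\<forall>i. Suc i < length \<pi> \<longrightarrow>
        (if even i then \<pi> ! i < \<pi> ! Suc i else \<pi> ! i > \<pi> ! Suc i))"

definition alternating_from_down :: "nat list \<Rightarrow> bool" where
  "alternating_from_down \<pi> \<longleftrightarrow>
     (\<forall>i. Suc i < length \<pi> \<longrightarrow>
        (if even i then \<pi> ! i > \<pi> ! Suc i else \<pi> ! i < \<pi> ! Suc i))"

definition up_down :: "nat \<Rightarrow> nat list set" where
  "up_down n = {\<pi> \<in> permutations_of_set {1..n}. n \<ge> 2 \<and> odd n \<and> alternating_from_up \<pi>}"

definition up_up :: "nat \<Rightarrow> nat list set" where
  "up_up n = {\<pi> \<in> permutations_of_set {1..n}. n \<ge> 2 \<and> even n \<and> alternating_from_up \<pi>}"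

definition down_up :: "nat \<Rightarrow> nat list set" where
  "down_up n = {\<pi> \<in> permutations_of_set {1..n}. n \<ge> 2 \<and> odd n \<and> alternating_from_down \<pi>}"

definition down_down :: "nat \<Rightarrow> nat list set" where
  "down_down n = {\<pi> \<in> permutations_of_set {1..n}. n \<ge> 2 \<and> even n \<and> alternating_from_down \<pi>}"

definition count_in :: "(nat \<Rightarrow> nat list set) \<Rightarrow> nat \<Rightarrow> nat \<Rightarrow> nat" where
  "count_in C k n =
     card {\<pi> \<in> C n. avoids [1, 3, 2] \<pi> \<and> contains_exactly 1 [1..<Suc k] \<pi>}"

text \<open>
  The formulas involve \<open>U\<^sub>r(1/(2x))\<close>, a polynomial in \<open>1/x\<close>, so the ordinary generating function
  is embedded into the field of formal Laurent series.
\<close>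

definition gen_fun :: "(nat \<Rightarrow> nat list set) \<Rightarrow> nat \<Rightarrow> rat fls" where
  "gen_fun C k = fps_to_fls (Abs_fps (\<lambda>n. of_nat (count_in C k n)))"

fun chebyshev_U_nat :: "nat \<Rightarrow> 'a :: comm_ring_1 poly" where
  "chebyshev_U_nat 0 = 1"
| "chebyshev_U_nat (Suc 0) = [:0, 2:]"
| "chebyshev_U_nat (Suc (Suc r)) = [:0, 2:] * chebyshev_U_nat (Suc r) - chebyshev_U_nat r"

text \<open>The index is an integer to accommodate \<open>U\<^sub>-\<^sub>1 = 0\<close>; values at \<open>r < -1\<close> are immaterial.\<close>

definition chebyshev_U :: "int \<Rightarrow> 'a :: comm_ring_1 poly" where
  "chebyshev_U r = (if r < 0 then 0 else chebyshev_U_nat (nat r))"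

lemma chebyshev_U_cos:
  assumes "r \<ge> -1"
  shows "poly (chebyshev_U r) (cos t) * sin t = sin ((of_int r + 1) * t :: real)"
proof -
  have *: "poly (chebyshev_U_nat n) (cos t) * sin t = sin ((real n + 1) * t)" for n
  proof (induction n rule: chebyshev_U_nat.induct)
    case (3 n)
    have "sin ((real n + 3) * t) + sin ((real n + 1) * t) = 2 * cos t * sin ((real n + 2) * t)"
      using sin_add[of "(real n + 2) * t" t] sin_diff[of "(real n + 2) * t" t]
      by (simp add: algebra_simps)
    with 3 show ?case by (simp add: algebra_simps)
  qed (simp_all add: sin_double)
  show ?thesis
  proof (cases "r < 0")
    case True
    with assms have "r = -1" by simp
    then show ?thesis by (simp add: chebyshev_U_def)
  next
    case False
    then show ?thesis using *[of "nat r"] by (simp add: chebyshev_U_def)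
  qed
qed

definition Ux :: "int \<Rightarrow> rat fls" where
  "Ux r = poly (chebyshev_U r) (1 / (2 * fls_X))"

end

theory Submission
  imports Defs "HOL-Library.Sublist"
begin

text \<open>
  Write a 132-avoiding permutation as \<open>L n R\<close>; every letter of \<open>L\<close> exceeds every letter of \<open>R\<close>,
  so these words are coded by binary trees. An increasing subsequence lies in \<open>L\<close>, in \<open>R\<close>,
  or is one of \<open>L\<close> followed by \<open>n\<close>; since a word with an increasing subsequence of length \<open>k \<ge> 2\<close>
  has at least two of length \<open>k - 1\<close>, exactly one occurrence for \<open>k\<close> means one occurrence for
  \<open>k - 1\<close> in \<open>L\<close> and none for \<open>k\<close> in \<open>R\<close>, or none for \<open>k - 1\<close> in \<open>L\<close> and one for \<open>k\<close> in \<open>R\<close>.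
  The resulting recurrences in \<open>k\<close> have the shape of the Chebyshev recursion: the series of
  up-down words avoiding \<open>1\<dots>k\<close> (including the word of length 1) is
  \<open>U\<^bsub>k-2\<^esub> / U\<^bsub>k-1\<^esub>\<close>.
\<close>

section \<open>Occurrences as subsequences\<close>

lemma subseq_map_iff:
  "subseq ys (map f xs) \<longleftrightarrow> (\<exists>zs. subseq zs xs \<and> ys = map f zs)"
proof
  assume "subseq ys (map f xs)"
  then obtain N where "ys = nths (map f xs) N" by (auto simp: subseq_conv_nths)
  then have "ys = map f (nths xs N)" by (simp add: nths_map)
  moreover have "subseq (nths xs N) xs" by (auto simp: subseq_conv_nths)
  ultimately show "\<exists>zs. subseq zs xs \<and> ys = map f zs" by blast
qed (auto intro: subseq_map)

lemma subseq_imp_set_subset: "subseq xs ys \<Longrightarrow> set xs \<subseteq> set ys"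
  by (auto elim: list_emb_set)

lemma subseq_upt_iff:
  "subseq is [0..<n] \<longleftrightarrow> sorted_wrt (<) is \<and> set is \<subseteq> {..<n}"
proof
  assume "subseq is [0..<n]"
  then obtain N where "is = nths [0..<n] N" by (auto simp: subseq_conv_nths)
  then show "sorted_wrt (<) is \<and> set is \<subseteq> {..<n}"
    using set_nths_subset[of "[0..<n]" N]
    by (auto simp: strict_sorted_iff sorted_nths distinct_nthsI)
next
  assume "sorted_wrt (<) is \<and> set is \<subseteq> {..<n}"
  then show "subseq is [0..<n]"
    by (intro sorted_subset_imp_subseq) (auto simp: strict_sorted_iff)
qed

text \<open>Order isomorphism looks only at the selected letters, and the admissible index tuples
  are the subsequences of \<open>[0..<length w]\<close>.\<close>

lemma image_nth_occurrences:
  "map ((!) w) ` occurrences \<tau> w = {ys. subseq ys w \<and> order_isomorphic ys \<tau>}"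
proof -
  have "subseq ys w \<longleftrightarrow> (\<exists>is. subseq is [0..<length w] \<and> ys = map ((!) w) is)" for ys
    using subseq_map_iff[of ys "(!) w" "[0..<length w]"] by (simp add: map_nth)
  then show ?thesis
    by (auto simp: occurrences_def subseq_upt_iff image_iff order_isomorphic_def)
qed

text \<open>Distinct letters determine their positions, so counting index tuples becomes counting
  subsequences.\<close>

lemma card_occurrences:
  assumes "distinct w"
  shows "card (occurrences \<tau> w) = card {ys. subseq ys w \<and> order_isomorphic ys \<tau>}"
proof -
  have "inj_on (map ((!) w)) (occurrences \<tau> w)"
  proof (rule inj_onI)
    fix xs ys
    assume "xs \<in> occurrences \<tau> w" "ys \<in> occurrences \<tau> w" "map ((!) w) xs = map ((!) w) ys"
    moreover have "inj_on ((!) w) {..<length w}"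
      using assms by (auto simp: inj_on_def nth_eq_iff_index_eq)
    ultimately show "xs = ys"
      by (auto simp: occurrences_def elim!: map_inj_on intro: inj_on_subset)
  qed
  then show ?thesis using card_image image_nth_occurrences by metis
qed

lemma order_isomorphic_upt_iff:
  "order_isomorphic ys [1..<Suc k] \<longleftrightarrow> length ys = k \<and> sorted_wrt (<) ys"
proof
  assume "order_isomorphic ys [1..<Suc k]"
  then show "length ys = k \<and> sorted_wrt (<) ys"
    by (auto simp: order_isomorphic_def sorted_wrt_iff_nth_less simp del: upt_Suc)
next
  assume *: "length ys = k \<and> sorted_wrt (<) ys"
  have "ys ! i < ys ! j \<longleftrightarrow> i < j" if "i < k" "j < k" for i j
    using * that by (metis linorder_less_linear order_less_asym sorted_wrt_iff_nth_less)
  then show "order_isomorphic ys [1..<Suc k]"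
    using * by (auto simp: order_isomorphic_def simp del: upt_Suc)
qed

section \<open>Avoiding 132, and its behaviour when a word is split at its maximum\<close>

lemma order_isomorphic_132_iff:
  "order_isomorphic ys [1, 3, 2] \<longleftrightarrow> (\<exists>a b c. ys = [a, b, c] \<and> a < c \<and> c < b)"
proof
  assume *: "order_isomorphic ys [1, 3, 2]"
  then have "length ys = 3" by (simp add: order_isomorphic_def)
  then obtain a b c where ys: "ys = [a, b, c]"
    by (auto simp: numeral_3_eq_3 length_Suc_conv)
  with * have "\<forall>i<3. \<forall>j<3. [a, b, c] ! i < [a, b, c] ! j \<longleftrightarrow> [1, 3, 2 :: nat] ! i < [1, 3, 2] ! j"
    by (simp add: order_isomorphic_def)
  from this[rule_format, of 0 2] this[rule_format, of 2 1] ys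
  show "\<exists>a b c. ys = [a, b, c] \<and> a < c \<and> c < b" by simp
next
  assume "\<exists>a b c. ys = [a, b, c] \<and> a < c \<and> c < b"
  then show "order_isomorphic ys [1, 3, 2]"
    by (auto simp: order_isomorphic_def less_Suc_eq numeral_3_eq_3)
qed

lemma avoids_132_iff:
  "avoids [1, 3, 2] w \<longleftrightarrow> (\<forall>a b c. subseq [a, b, c] w \<longrightarrow> a < c \<longrightarrow> \<not> c < b)"
proof -
  have "avoids [1, 3, 2] w \<longleftrightarrow> map ((!) w) ` occurrences [1, 3, 2] w = {}"
    by (simp add: avoids_def contains_exactly_def finite_occurrences)
  also have "\<dots> \<longleftrightarrow> (\<forall>a b c. subseq [a, b, c] w \<longrightarrow> a < c \<longrightarrow> \<not> c < b)"
    unfolding image_nth_occurrences order_isomorphic_132_iff by blast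
  finally show ?thesis .
qed

lemma avoids_132_subseq:
  assumes "avoids [1, 3, 2] w" "subseq v w"
  shows "avoids [1, 3, 2] v"
  using assms unfolding avoids_132_iff by (meson subseq_order.order_trans)

text \<open>If \<open>x < y\<close> with \<open>x\<close> before and \<open>y\<close> after the
  maximum \<open>m\<close>, then \<open>x, m, y\<close> is an occurrence. Conversely, an occurrence
  starting in \<open>u\<close> and ending outside it has its last letter either in \<open>v\<close>,
  hence below its first, or equal to \<open>m\<close>, hence not below its middle letter.\<close>

lemma avoids_132_append_Cons:
  assumes "distinct (u @ m # v)" "\<forall>x \<in> set u \<union> set v. x < m"
  shows "avoids [1, 3, 2] (u @ m # v) \<longleftrightarrow>
    avoids [1, 3, 2] u \<and> avoids [1, 3, 2] v \<and> (\<forall>x\<in>set u. \<forall>y\<in>set v. y < x)"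
proof (intro iffI conjI ballI)
  assume *: "avoids [1, 3, 2] (u @ m # v)"
  show "avoids [1, 3, 2] u" "avoids [1, 3, 2] v"
    by (rule avoids_132_subseq[OF *]; auto intro: list_emb_append2)+
  fix x y assume xy: "x \<in> set u" "y \<in> set v"
  have "subseq ([x] @ [m] @ [y]) (u @ [m] @ v)"
    using xy by (intro list_emb_append_mono) (auto simp: subseq_singleton_left)
  then have "subseq [x, m, y] (u @ m # v)" by simp
  then have "\<not> x < y" using * assms(2) xy unfolding avoids_132_iff by blast
  moreover have "x \<noteq> y" using assms(1) xy by auto
  ultimately show "y < x" by simp
next
  assume *: "avoids [1, 3, 2] u \<and> avoids [1, 3, 2] v \<and> (\<forall>x\<in>set u. \<forall>y\<in>set v. y < x)"
  show "avoids [1, 3, 2] (u @ m # v)"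
    unfolding avoids_132_iff
  proof (intro allI impI notI)
    fix a b c assume sub: "subseq [a, b, c] (u @ m # v)" and less: "a < c" "c < b"
    from sub obtain xs ys where split: "[a, b, c] = xs @ ys" "subseq xs u" "subseq ys (m # v)"
      by (auto simp: subseq_append_iff)
    have sets: "set xs \<subseteq> set u" "set ys \<subseteq> insert m (set v)"
      using subseq_imp_set_subset[OF split(2)] subseq_imp_set_subset[OF split(3)] by auto
    consider "xs = []" | "xs = [a, b, c]" | "a \<in> set xs" "c \<in> set ys"
      using split(1) by (cases xs; cases ys rule: rev_cases) (auto simp: Cons_eq_append_conv)
    then show False
    proof cases
      case 1
      with split have "subseq [a, b, c] (m # v)" by simp
      \<comment> \<open>The first letter of an occurrence is its smallest, so it cannot be the
        maximum.\<close>
      moreover have "a \<noteq> m"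
        using 1 split(1) sets(2) less assms(2) by (auto dest!: bspec[of _ _ c])
      ultimately have "subseq [a, b, c] v" by (auto elim: list_emb.cases)
      with * less show False unfolding avoids_132_iff by blast
    next
      case 2
      with split * less show False unfolding avoids_132_iff by blast
    next
      case 3
      then have "a \<in> set u" "c = m \<or> c \<in> set v" using sets by auto
      moreover have "c \<notin> set v" using * less \<open>a \<in> set u\<close> by (meson order_less_asym)
      ultimately have "m < b" using less by simp
      moreover have "b \<in> set u \<union> insert m (set v)"
      proof -
        have "b \<in> set (xs @ ys)" unfolding split(1)[symmetric] by simp
        then show ?thesis using sets by auto
      qed
      ultimately show False using assms(2) by (auto dest: order_less_asym)
    qed
  qed
qed

section \<open>Trees and 132-avoiding words\<close>

datatype bintree = Leaf | Node bintree bintree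

text \<open>\<open>a\<close> is an offset: the letters start at \<open>Suc a\<close>. The right
  subtree gets the lower letters, as 132-avoidance demands; \<open>size\<close> counts the nodes,
  one per letter.\<close>

fun word :: "nat \<Rightarrow> bintree \<Rightarrow> nat list" where
  "word a Leaf = []"
| "word a (Node l r) = word (a + size r) l @ Suc (a + size l + size r) # word a r"

lemma length_word [simp]: "length (word a t) = size t"
  by (induction a t rule: word.induct) auto

lemma set_word [simp]: "set (word a t) = {a<..a + size t}"
  by (induction a t rule: word.induct) auto

lemma distinct_word [simp]: "distinct (word a t)"
  by (induction a t rule: word.induct) auto

lemma word_eq_Nil_iff [simp]: "word a t = [] \<longleftrightarrow> t = Leaf"
  by (cases t) auto

lemma word_inject: "word a s = word a t \<Longrightarrow> s = t"
proof (induction s arbitrary: a t)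
  case Leaf
  then show ?case by (metis word.simps(1) word_eq_Nil_iff)
next
  case (Node l r)
  from Node.prems obtain l' r' where t: "t = Node l' r'"
    by (cases t) auto
  have "size (Node l r) = size t" using Node.prems by (metis length_word)
  then have size: "size l + size r = size l' + size r'" using t by simp
  \<comment> \<open>Equal sizes give both words the same maximum, which occurs once and so fixes
    where they split.\<close>
  then have eq: "word (a + size r) l @ Suc (a + size l + size r) # word a r =
      word (a + size r') l' @ Suc (a + size l + size r) # word a r'"
    using Node.prems t by (simp add: add.assoc)
  have l: "word (a + size r) l = word (a + size r') l'" and r: "word a r = word a r'"
    using eq size by (subst (asm) append_Cons_eq_iff; simp)+
  have "size r = size r'" using r by (metis length_word)
  then show ?case using Node.IH l r t by metis
qed

lemma avoids_132_word: "avoids [1, 3, 2] (word a t)"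
proof (induction a t rule: word.induct)
  case (1 a)
  show ?case unfolding avoids_132_iff by simp
next
  case (2 a l r)
  have "distinct (word a (Node l r))" by (rule distinct_word)
  then show ?case
    using 2 unfolding word.simps by (subst avoids_132_append_Cons) auto
qed

text \<open>No element of \<open>U\<close> lies below \<open>Max V\<close>, so \<open>V\<close> is
  an initial segment. Thus the letters on each side of the maximum form an interval, as the
  induction for \<open>ex_word\<close> requires.\<close>

lemma lower_part_of_interval:
  fixes a b :: nat
  assumes "U \<union> V = {a<..b}" "\<forall>x\<in>U. \<forall>y\<in>V. y < x"
  shows "V = {a<..a + card V}" "U = {a + card V<..b}"
proof -
  have fin: "finite V" using assms(1) by (metis finite_Un finite_greaterThanAtMost)
  show V: "V = {a<..a + card V}"
  proof (cases "V = {}")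
    case False
    have "V = {a<..Max V}"
    proof
      show "V \<subseteq> {a<..Max V}" using assms(1) fin by (auto intro: Max_ge)
      show "{a<..Max V} \<subseteq> V"
      proof
        fix x assume x: "x \<in> {a<..Max V}"
        have M: "Max V \<in> V" using fin False by simp
        then have "Max V \<le> b" using assms(1) by auto
        then have "x \<in> U \<union> V" using x assms(1) by auto
        moreover have "x \<notin> U" using assms(2) M x by (meson greaterThanAtMost_iff leD)
        ultimately show "x \<in> V" by simp
      qed
    qed
    then have "V = {a<..Max V} \<and> card V = Max V - a" by (metis card_greaterThanAtMost)
    moreover have "a < Max V" using False fin assms(1) Max_in by fastforce
    ultimately show ?thesis by simp
  qed simp
  have "U \<inter> V = {}" using assms(2) by auto
  then have "U = {a<..b} - V" using assms(1) by auto
  also have "\<dots> = {a + card V<..b}" by (subst V) auto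
  finally show "U = {a + card V<..b}" .
qed

text \<open>Splitting at the largest letter \<open>a + length w\<close> leaves two shorter words
  satisfying the same hypotheses, with offsets \<open>a + length v\<close> and
  \<open>a\<close>.\<close>

lemma ex_word:
  assumes "distinct w" "set w = {a<..a + length w}" "avoids [1, 3, 2] w"
  shows "\<exists>t. w = word a t"
  using assms
proof (induction "length w" arbitrary: w a rule: less_induct)
  case less
  show ?case
  proof (cases "w = []")
    case True
    then show ?thesis by (intro exI[of _ Leaf]) simp
  next
    case False
    define m where "m = a + length w"
    have "m \<in> set w" using False less.prems(2) by (auto simp: m_def)
    then obtain u v where w: "w = u @ m # v" by (meson split_list)
    have m: "m = Suc (a + length u + length v)" unfolding m_def by (subst w) simp
    have dist: "distinct (u @ m # v)" using less.prems(1) w by simp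
    have "set u \<union> set v = set w - {m}" using dist by (auto simp: w)
    also have "\<dots> = {a<..a + length u + length v}"
      unfolding less.prems(2) by (auto simp: w m)
    finally have un: "set u \<union> set v = {a<..a + length u + length v}" .
    then have "\<forall>x \<in> set u \<union> set v. x < m" by (simp add: m)
    with avoids_132_append_Cons[OF dist] less.prems(3)
    have av: "avoids [1, 3, 2] u" "avoids [1, 3, 2] v" "\<forall>x\<in>set u. \<forall>y\<in>set v. y < x"
      by (simp_all add: w)
    have "card (set v) = length v" using dist by (simp add: distinct_card)
    with lower_part_of_interval[OF un av(3)]
    have "set v = {a<..a + length v}" "set u = {a + length v<..a + length v + length u}"
      by (simp_all add: ac_simps)
    then obtain r l where r: "v = word a r" and l: "u = word (a + length v) l"
      using less.hyps[of v a] less.hyps[of u "a + length v"] dist av w by auto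
    have "w = word a (Node l r)"
      using r l length_word[of "a + length v" l] by (simp add: w m ac_simps)
    then show ?thesis by blast
  qed
qed

lemma avoiding_132_eq_words:
  "{\<pi> \<in> permutations_of_set {1..n}. avoids [1, 3, 2] \<pi>} = word 0 ` {t. size t = n}"
proof (intro equalityI subsetI)
  fix \<pi> assume "\<pi> \<in> {\<pi> \<in> permutations_of_set {1..n}. avoids [1, 3, 2] \<pi>}"
  then have \<pi>: "set \<pi> = {1..n}" "distinct \<pi>" "avoids [1, 3, 2] \<pi>"
    by (auto simp: permutations_of_set_def)
  then have n: "length \<pi> = n" using distinct_card[OF \<pi>(2)] by simp
  have "set \<pi> = {0<..0 + length \<pi>}" unfolding n \<pi>(1) by auto
  with ex_word[of \<pi> 0] \<pi> obtain t where "\<pi> = word 0 t" by blast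
  with n show "\<pi> \<in> word 0 ` {t. size t = n}" by auto
qed (auto simp: permutations_of_set_def avoids_132_word simp del: One_nat_def)

section \<open>Increasing subsequences\<close>

definition inc_subseqs :: "nat \<Rightarrow> nat list \<Rightarrow> nat list set" where
  "inc_subseqs k w = {ys. subseq ys w \<and> length ys = k \<and> sorted_wrt (<) ys}"

lemma finite_inc_subseqs [simp]: "finite (inc_subseqs k w)"
proof (rule finite_subset)
  show "inc_subseqs k w \<subseteq> set (subseqs w)" by (auto simp: inc_subseqs_def)
qed simp

fun tree_occ :: "nat \<Rightarrow> bintree \<Rightarrow> nat" where
  "tree_occ 0 t = 1"
| "tree_occ (Suc k) Leaf = 0"
| "tree_occ (Suc k) (Node l r) = tree_occ (Suc k) l + tree_occ k l + tree_occ (Suc k) r"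

text \<open>Nothing after \<open>m\<close> can follow it in an increasing subsequence, and passing
  from \<open>u\<close> to \<open>v\<close> is a descent.\<close>

lemma inc_subseqs_append_Cons:
  assumes "\<forall>x \<in> set u \<union> set v. x < m" "\<forall>x\<in>set u. \<forall>y\<in>set v. y < x"
  shows "inc_subseqs (Suc k) (u @ m # v) =
    inc_subseqs (Suc k) u \<union> (\<lambda>ys. ys @ [m]) ` inc_subseqs k u \<union> inc_subseqs (Suc k) v"
    (is "?L = ?A \<union> ?B \<union> ?C")
proof (intro equalityI subsetI)
  fix zs assume "zs \<in> ?L"
  then obtain xs ys where zs: "zs = xs @ ys" "subseq xs u" "subseq ys (m # v)"
    "length zs = Suc k" "sorted_wrt (<) zs"
    by (auto simp: inc_subseqs_def subseq_append_iff)
  have xs: "set xs \<subseteq> set u" using zs(2) subseq_imp_set_subset by blast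
  show "zs \<in> ?A \<union> ?B \<union> ?C"
  proof (cases "\<exists>ys'. ys = m # ys'")
    case True
    then obtain ys' where ys: "ys = m # ys'" by blast
    then have "subseq ys' v" using zs(3) by simp
    then have "set ys' \<subseteq> set v" using subseq_imp_set_subset by blast
    then have "ys' = []" using zs(5) assms(1) unfolding zs(1) ys
      by (cases ys') (auto simp: sorted_wrt_append dest: order_less_asym)
    then show ?thesis using zs ys by (auto simp: inc_subseqs_def sorted_wrt_append)
  next
    case False
    then have ys: "subseq ys v" using zs(3) by (cases ys) (auto split: if_splits)
    then have sub: "set ys \<subseteq> set v" using subseq_imp_set_subset by blast
    have "xs = [] \<or> ys = []"
    proof (rule ccontr)
      assume "\<not> ?thesis"
      then obtain x y where "x \<in> set xs" "y \<in> set ys" by (meson last_in_set)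
      moreover from this have "x < y" using zs(5) by (simp add: zs(1) sorted_wrt_append)
      ultimately show False using sub xs assms(2) by (meson order_less_asym subsetD)
    qed
    then show ?thesis using zs ys by (auto simp: inc_subseqs_def)
  qed
next
  fix zs assume "zs \<in> ?A \<union> ?B \<union> ?C"
  then consider "zs \<in> ?A" | "zs \<in> ?B" | "zs \<in> ?C" by blast
  then show "zs \<in> ?L"
  proof cases
    case 1
    then show ?thesis by (auto simp: inc_subseqs_def)
  next
    case 2
    then obtain ys where ys: "zs = ys @ [m]" "subseq ys u" "length ys = k" "sorted_wrt (<) ys"
      by (auto simp: inc_subseqs_def)
    have "subseq (ys @ [m]) (u @ m # v)"
      by (rule list_emb_append_mono) (use ys in auto)
    moreover have "\<forall>y\<in>set ys. y < m" using ys(2) assms(1) subseq_imp_set_subset by fastforce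
    ultimately show ?thesis using ys by (auto simp: inc_subseqs_def sorted_wrt_append)
  next
    case 3
    then show ?thesis by (auto simp: inc_subseqs_def intro: list_emb_append2)
  qed
qed

lemma card_inc_subseqs_word: "card (inc_subseqs k (word a t)) = tree_occ k t"
proof (induction k t arbitrary: a rule: tree_occ.induct)
  case (1 t)
  have "inc_subseqs 0 (word a t) = {[]}" by (auto simp: inc_subseqs_def)
  then show ?case by simp
next
  case (2 k)
  have "inc_subseqs (Suc k) (word a Leaf) = {}" by (auto simp: inc_subseqs_def)
  then show ?case by simp
next
  case (3 k l r)
  let ?u = "word (a + size r) l" and ?m = "Suc (a + size l + size r)" and ?v = "word a r"
  have eq: "inc_subseqs (Suc k) (word a (Node l r)) =
    inc_subseqs (Suc k) ?u \<union> (\<lambda>ys. ys @ [?m]) ` inc_subseqs k ?u \<union> inc_subseqs (Suc k) ?v"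
    unfolding word.simps by (rule inc_subseqs_append_Cons) auto
  \<comment> \<open>The three families are disjoint because \<open>u\<close>, \<open>m\<close> and
    \<open>v\<close> use disjoint letters and the subsequences are nonempty.\<close>
  have subs: "ys \<noteq> [] \<and> set ys \<subseteq> {b<..b + size t}"
    if "ys \<in> inc_subseqs (Suc k) (word b t)" for ys b t
    using that subseq_imp_set_subset[of ys "word b t"] by (auto simp: inc_subseqs_def)
  have "inc_subseqs (Suc k) ?u \<inter> (\<lambda>ys. ys @ [?m]) ` inc_subseqs k ?u = {}"
    by (auto dest!: subs)
  moreover have "(inc_subseqs (Suc k) ?u \<union> (\<lambda>ys. ys @ [?m]) ` inc_subseqs k ?u)
      \<inter> inc_subseqs (Suc k) ?v = {}"
  proof -
    have False if "ys \<in> inc_subseqs (Suc k) ?u" "ys \<in> inc_subseqs (Suc k) ?v" for ys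
      using subs[OF that(1)] subs[OF that(2)] by (cases ys) auto
    moreover have False if "ys @ [?m] \<in> inc_subseqs (Suc k) ?v" for ys
      using subs[OF that] by simp
    ultimately show ?thesis by blast
  qed
  moreover have "card ((\<lambda>ys. ys @ [?m]) ` inc_subseqs k ?u) = card (inc_subseqs k ?u)"
    by (intro card_image) (simp add: inj_on_def)
  ultimately show ?case
    unfolding eq by (subst card_Un_disjoint; simp)+ (simp add: 3)
qed

lemma contains_exactly_word:
  "contains_exactly c [1..<Suc k] (word a t) \<longleftrightarrow> tree_occ k t = c"
  unfolding contains_exactly_def card_inc_subseqs_word[of k a t, symmetric]
  by (simp only: card_occurrences[OF distinct_word] order_isomorphic_upt_iff inc_subseqs_def)

lemma tree_occ_1 [simp]: "tree_occ (Suc 0) t = size t"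
  by (induction t) auto

text \<open>Makes the condition \<open>n \<ge> 2\<close> of the permutation classes automatic once
  an occurrence of length \<open>k \<ge> 2\<close> exists.\<close>

lemma tree_occ_le_size: "tree_occ k t > 0 \<Longrightarrow> k \<le> size t"
  by (induction k t rule: tree_occ.induct) force+

text \<open>Deleting different letters of an increasing subsequence gives different shorter ones;
  the proof runs this by induction on the tree.\<close>

lemma tree_occ_Suc_Suc_pos: "tree_occ (Suc (Suc j)) t > 0 \<Longrightarrow> tree_occ (Suc j) t \<ge> 2"
proof (induction t arbitrary: j)
  case (Node l r)
  consider "tree_occ (Suc (Suc j)) l > 0" | "tree_occ (Suc (Suc j)) r > 0" | "tree_occ (Suc j) l > 0"
    using Node.prems by auto
  then show ?case
  proof cases
    case 3
    show ?thesis
    proof (cases j)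
      case (Suc i)
      with 3 Node.IH(1)[of i] show ?thesis by simp
    qed (use 3 in simp)
  qed (use Node.IH[of j] in auto)
qed simp

lemma tree_occ_Node_eq_0:
  "tree_occ (Suc (Suc j)) (Node l r) = 0 \<longleftrightarrow> tree_occ (Suc j) l = 0 \<and> tree_occ (Suc (Suc j)) r = 0"
  using tree_occ_Suc_Suc_pos[of j l] by (cases "tree_occ (Suc (Suc j)) l") auto

text \<open>An occurrence of the full length inside \<open>l\<close> would bring two shorter ones in
  \<open>l\<close>, each extended by the root, hence a total of at least three. So the first summand
  vanishes and the single occurrence comes from one of the other two.\<close>

lemma tree_occ_Node_eq_1:
  "tree_occ (Suc (Suc j)) (Node l r) = 1 \<longleftrightarrow>
    tree_occ (Suc j) l = 1 \<and> tree_occ (Suc (Suc j)) r = 0 \<or>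
    tree_occ (Suc j) l = 0 \<and> tree_occ (Suc (Suc j)) r = 1"
  using tree_occ_Suc_Suc_pos[of j l] by (cases "tree_occ (Suc (Suc j)) l") auto

section \<open>Alternation\<close>

text \<open>The flag is the direction of the first step; an induction can flip it, which the two
  fixed-direction predicates do not allow.\<close>

fun alternating :: "bool \<Rightarrow> nat list \<Rightarrow> bool" where
  "alternating b (x # y # w) \<longleftrightarrow> (if b then x < y else y < x) \<and> alternating (\<not> b) (y # w)"
| "alternating b w \<longleftrightarrow> True"

lemma alternating_iff_nth:
  "alternating b w \<longleftrightarrow>
    (\<forall>i. Suc i < length w \<longrightarrow> (if even i = b then w ! i < w ! Suc i else w ! i > w ! Suc i))"
proof (induction b w rule: alternating.induct)
  case (1 b x y w)
  have "(\<forall>i. Suc i < length (x # y # w) \<longrightarrow> (if even i = b then (x # y # w) ! i < (x # y # w) ! Suc i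
            else (x # y # w) ! i > (x # y # w) ! Suc i)) \<longleftrightarrow>
    (if b then x < y else y < x) \<and>
    (\<forall>i. Suc i < length (y # w) \<longrightarrow> (if even i = (\<not> b) then (y # w) ! i < (y # w) ! Suc i
            else (y # w) ! i > (y # w) ! Suc i))" (is "(\<forall>i. ?P i) \<longleftrightarrow> _")
  proof -
    have all_nat: "(\<forall>i. R i) \<longleftrightarrow> R 0 \<and> (\<forall>i. R (Suc i))" for R :: "nat \<Rightarrow> bool"
      by (metis not0_implies_Suc)
    show ?thesis by (subst all_nat[of ?P]) auto
  qed
  then show ?case using 1 by simp
qed auto

lemma alternating_from_up_iff: "alternating_from_up w \<longleftrightarrow> alternating True w"
  by (simp add: alternating_from_up_def alternating_iff_nth)

lemma alternating_from_down_iff: "alternating_from_down w \<longleftrightarrow> alternating False w"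
  by (auto simp: alternating_from_down_def alternating_iff_nth)

text \<open>The step into \<open>m\<close> ascends and the step out of it descends; either one fixes
  the parity of \<open>length u\<close>, and \<open>v\<close> then begins with an ascent. A single
  letter has no steps and fits both directions.\<close>

lemma alternating_append_Cons:
  assumes "\<forall>x \<in> set u \<union> set v. x < m"
  shows "alternating b (u @ m # v) \<longleftrightarrow>
    u = [] \<and> v = [] \<or> odd (length u) = b \<and> alternating b u \<and> alternating True v"
  using assms
proof (induction b u rule: alternating.induct)
  case (1 b x y w)
  then show ?case by auto
next
  case ("2_1" b)
  then show ?case by (cases v) auto
next
  case ("2_2" b x)
  then show ?case by (cases v) auto
qed

fun tree_alternating :: "bool \<Rightarrow> bintree \<Rightarrow> bool" where
  "tree_alternating b Leaf \<longleftrightarrow> True"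
| "tree_alternating b (Node l r) \<longleftrightarrow>
    l = Leaf \<and> r = Leaf \<or> odd (size l) = b \<and> tree_alternating b l \<and> tree_alternating True r"

lemma alternating_word: "alternating b (word a t) \<longleftrightarrow> tree_alternating b t"
proof (induction a t arbitrary: b rule: word.induct)
  case (2 a l r)
  then show ?case
    unfolding word.simps tree_alternating.simps by (subst alternating_append_Cons) auto
qed simp

section \<open>Generating functions of tree classes\<close>

lemma finite_trees_of_size: "finite {t :: bintree. size t = n}"
proof (rule finite_imageD)
  show "finite (word 0 ` {t. size t = n})"
    unfolding avoiding_132_eq_words[symmetric] by simp
  show "inj_on (word 0) {t. size t = n}"
    using word_inject by (auto simp: inj_on_def)
qed

definition tree_fps :: "bintree set \<Rightarrow> rat fps" where
  "tree_fps A = Abs_fps (\<lambda>n. of_nat (card {t \<in> A. size t = n}))"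

lemma tree_fps_empty [simp]: "tree_fps {} = 0"
  by (simp add: tree_fps_def fps_eq_iff)

lemma tree_fps_Leaf [simp]: "tree_fps {Leaf} = 1"
proof -
  have "{t \<in> {Leaf}. size t = n} = (if n = 0 then {Leaf} else {})" for n by auto
  then show ?thesis by (simp add: tree_fps_def fps_eq_iff)
qed

lemma tree_fps_Node_Leaf [simp]: "tree_fps {Node Leaf Leaf} = fps_X"
proof -
  have "{t \<in> {Node Leaf Leaf}. size t = n} = (if n = 1 then {Node Leaf Leaf} else {})" for n by auto
  then show ?thesis by (simp add: tree_fps_def fps_eq_iff)
qed

lemma tree_fps_Un:
  assumes "A \<inter> B = {}"
  shows "tree_fps (A \<union> B) = tree_fps A + tree_fps B"
proof -
  have "card {t \<in> A \<union> B. size t = n} = card {t \<in> A. size t = n} + card {t \<in> B. size t = n}" for n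
  proof -
    have "{t \<in> A \<union> B. size t = n} = {t \<in> A. size t = n} \<union> {t \<in> B. size t = n}" by auto
    then show ?thesis
      using assms by (auto intro!: card_Un_disjoint finite_subset[OF _ finite_trees_of_size[of n]])
  qed
  then show ?thesis by (simp add: tree_fps_def fps_eq_iff)
qed

definition nodes :: "bintree set \<Rightarrow> bintree set \<Rightarrow> bintree set" where
  "nodes A B = (\<lambda>(l, r). Node l r) ` (A \<times> B)"

lemma Leaf_notin_nodes [simp]: "Leaf \<notin> nodes A B"
  and Node_in_nodes [simp]: "Node l r \<in> nodes A B \<longleftrightarrow> l \<in> A \<and> r \<in> B"
  by (auto simp: nodes_def)

text \<open>The root contributes \<open>fps_X\<close>; the remaining \<open>m\<close> letters split
  as \<open>i\<close> and \<open>m - i\<close>, a Cauchy product.\<close>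

lemma tree_fps_nodes: "tree_fps (nodes A B) = fps_X * (tree_fps A * tree_fps B)"
proof (rule fps_ext)
  fix n
  let ?S = "\<lambda>C n. {t :: bintree. t \<in> C \<and> size t = n}"
  show "tree_fps (nodes A B) $ n = (fps_X * (tree_fps A * tree_fps B)) $ n"
  proof (cases n)
    case 0
    have "?S (nodes A B) 0 = {}" by (auto simp: nodes_def)
    then have "card (?S (nodes A B) 0) = 0" by (simp only: card.empty)
    then show ?thesis using 0 by (simp add: tree_fps_def)
  next
    case (Suc m)
    have fin: "finite (?S C i)" for C i
      by (rule finite_subset[OF _ finite_trees_of_size[of i]]) auto
    have "?S (nodes A B) (Suc m) =
        (\<lambda>(l, r). Node l r) ` (\<Union>i\<in>{0..m}. ?S A i \<times> ?S B (m - i))"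
      by (force simp: nodes_def)
    also have "card \<dots> = card (\<Union>i\<in>{0..m}. ?S A i \<times> ?S B (m - i))"
      by (intro card_image) (auto simp: inj_on_def)
    also have "\<dots> = (\<Sum>i=0..m. card (?S A i \<times> ?S B (m - i)))"
      using fin by (intro card_UN_disjoint) auto
    finally have "tree_fps (nodes A B) $ n = (tree_fps A * tree_fps B) $ m"
      using Suc by (simp add: tree_fps_def fps_mult_nth card_cartesian_product)
    then show ?thesis using Suc by simp
  qed
qed

text \<open>
  \<open>b\<close> says whether the word starts with an ascent, \<open>p\<close> whether its length is odd. Unlike the
  classes of the theorem, these contain words of length 0 and 1.
\<close>

definition tree_class :: "bool \<Rightarrow> bool \<Rightarrow> nat \<Rightarrow> nat \<Rightarrow> bintree set" where
  "tree_class b p k c = {t. tree_alternating b t \<and> odd (size t) = p \<and> tree_occ k t = c}"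

definition G :: "bool \<Rightarrow> bool \<Rightarrow> nat \<Rightarrow> nat \<Rightarrow> rat fps" where
  "G b p k c = tree_fps (tree_class b p k c)"

lemma tree_set_eqI:
  assumes "Leaf \<in> A \<longleftrightarrow> Leaf \<in> B" "\<And>l r. Node l r \<in> A \<longleftrightarrow> Node l r \<in> B"
  shows "A = B"
  using assms by (metis bintree.exhaust subset_antisym subsetI)

lemma disjoint_nodes:
  "A \<inter> A' = {} \<or> B \<inter> B' = {} \<Longrightarrow> nodes A B \<inter> nodes A' B' = {}"
  by (auto simp: nodes_def)

lemma tree_class_disjoint: "c \<noteq> d \<Longrightarrow> tree_class b p k c \<inter> tree_class b p k d = {}"
  by (auto simp: tree_class_def)

text \<open>
  The maximum splits the word into a left part whose length has the parity dictated by the first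
  step, and a right part that always starts with an ascent.
\<close>

lemma G_exactly_one:
  "G b p (Suc (Suc j)) 1 =
     fps_X * (G b b (Suc j) 1 * G True (p = b) (Suc (Suc j)) 0
            + G b b (Suc j) 0 * G True (p = b) (Suc (Suc j)) 1)"
proof -
  have eq: "tree_class b p (Suc (Suc j)) 1 =
      nodes (tree_class b b (Suc j) 1) (tree_class True (p = b) (Suc (Suc j)) 0) \<union>
      nodes (tree_class b b (Suc j) 0) (tree_class True (p = b) (Suc (Suc j)) 1)"
  proof (rule tree_set_eqI)
    fix l r
    show "Node l r \<in> tree_class b p (Suc (Suc j)) 1 \<longleftrightarrow> Node l r \<in>
        nodes (tree_class b b (Suc j) 1) (tree_class True (p = b) (Suc (Suc j)) 0) \<union>
        nodes (tree_class b b (Suc j) 0) (tree_class True (p = b) (Suc (Suc j)) 1)"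
      \<comment> \<open>The one-letter exception in \<open>tree_alternating\<close> drops out,
        having no occurrence. If \<open>size l\<close> has parity \<open>b\<close>, the total has
        parity \<open>p\<close> exactly when \<open>size r\<close> has parity
        \<open>p = b\<close>.\<close>
      unfolding tree_class_def Un_iff Node_in_nodes mem_Collect_eq tree_occ_Node_eq_1
      by auto
  qed (simp add: tree_class_def)
  have "nodes (tree_class b b (Suc j) 1) (tree_class True (p = b) (Suc (Suc j)) 0) \<inter>
      nodes (tree_class b b (Suc j) 0) (tree_class True (p = b) (Suc (Suc j)) 1) = {}"
    by (intro disjoint_nodes disjI1 tree_class_disjoint) simp
  from tree_fps_Un[OF this] show ?thesis
    unfolding G_def eq tree_fps_nodes distrib_left .
qed

text \<open>The extra term is the empty word or the one-letter word. For down-up words, excluded by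
  the assumption, the one-letter word already lies in \<open>nodes\<close> and would be counted
  twice.\<close>

lemma G_avoiding:
  assumes "b \<or> \<not> p"
  shows "G b p (Suc (Suc j)) 0 =
     (if p then fps_X else 1) + fps_X * (G b b (Suc j) 0 * G True (p = b) (Suc (Suc j)) 0)"
proof -
  have "tree_class b p (Suc (Suc j)) 0 = (if p then {Node Leaf Leaf} else {Leaf}) \<union>
      nodes (tree_class b b (Suc j) 0) (tree_class True (p = b) (Suc (Suc j)) 0)"
  proof (rule tree_set_eqI)
    fix l r
    show "Node l r \<in> tree_class b p (Suc (Suc j)) 0 \<longleftrightarrow> Node l r \<in>
        (if p then {Node Leaf Leaf} else {Leaf}) \<union>
        nodes (tree_class b b (Suc j) 0) (tree_class True (p = b) (Suc (Suc j)) 0)"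
      using assms
      unfolding tree_class_def Un_iff Node_in_nodes mem_Collect_eq tree_occ_Node_eq_0
      by auto
  qed (simp add: tree_class_def)
  moreover have "(if p then {Node Leaf Leaf} else {Leaf}) \<inter>
      nodes (tree_class b b (Suc j) 0) (tree_class True (p = b) (Suc (Suc j)) 0) = {}"
    using assms by (auto simp: tree_class_def)
  ultimately show ?thesis
    by (simp add: G_def tree_fps_Un tree_fps_nodes)
qed

text \<open>Base of the recursion in \<open>k\<close>: for \<open>k = 1\<close> the occurrences are
  the letters themselves.\<close>

lemma G_1:
  "G True True (Suc 0) 0 = 0" "G True True (Suc 0) 1 = fps_X"
  "G False False (Suc 0) 0 = 1" "G False False (Suc 0) 1 = 0"
proof -
  have "tree_class True True (Suc 0) 0 = {}" "tree_class False False (Suc 0) 1 = {}"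
    by (auto simp: tree_class_def)
  moreover have "tree_class True True (Suc 0) 1 = {Node Leaf Leaf}"
    "tree_class False False (Suc 0) 0 = {Leaf}"
    by (rule tree_set_eqI; auto simp: tree_class_def)+
  ultimately show "G True True (Suc 0) 0 = 0" "G True True (Suc 0) 1 = fps_X"
    "G False False (Suc 0) 0 = 1" "G False False (Suc 0) 1 = 0"
    by (simp_all add: G_def)
qed

lemma gen_fun_eq_G:
  assumes "k \<ge> 2"
    and C: "\<And>n. C n = {\<pi> \<in> permutations_of_set {1..n}. n \<ge> 2 \<and> odd n = p \<and> alternating b \<pi>}"
  shows "gen_fun C k = fps_to_fls (G b p k 1)"
proof -
  have "count_in C k n = card {t \<in> tree_class b p k 1. size t = n}" for n
  proof -
    have "{\<pi> \<in> C n. avoids [1, 3, 2] \<pi> \<and> contains_exactly 1 [1..<Suc k] \<pi>} =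
      {\<pi> \<in> {\<pi> \<in> permutations_of_set {1..n}. avoids [1, 3, 2] \<pi>}.
         n \<ge> 2 \<and> odd n = p \<and> alternating b \<pi> \<and> contains_exactly 1 [1..<Suc k] \<pi>}"
      unfolding C by blast
    also have "\<dots> = word 0 ` {t. size t = n \<and> n \<ge> 2 \<and> odd n = p \<and>
        tree_alternating b t \<and> tree_occ k t = 1}"
      unfolding avoiding_132_eq_words
      using contains_exactly_word[of 1 k 0] by (auto simp: alternating_word simp del: upt_Suc One_nat_def)
    also have "{t. size t = n \<and> n \<ge> 2 \<and> odd n = p \<and> tree_alternating b t \<and> tree_occ k t = 1} =
        {t \<in> tree_class b p k 1. size t = n}"
    proof -
      have "size t \<ge> 2" if "tree_occ k t = 1" for t
        using tree_occ_le_size[of k t] assms(1) that by simp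
      then show ?thesis by (auto simp: tree_class_def)
    qed
    finally show ?thesis
      unfolding count_in_def by (simp add: card_image inj_on_def word_inject)
  qed
  then show ?thesis by (simp add: gen_fun_def G_def tree_fps_def)
qed

section \<open>Solving the recurrences\<close>

text \<open>
  The index \<open>j\<close> stands for pattern length \<open>k = j + 1\<close>, and \<open>V j\<close> for \<open>U\<^bsub>j-1\<^esub>\<close>. Capital letters count words
  without an occurrence, small ones words with exactly one: \<open>P, p\<close> up-down, \<open>Q, q\<close> up-up,
  \<open>E, e\<close> down-down, \<open>f\<close> down-up.
\<close>

locale avoider_recurrences =
  fixes x :: "'a :: field" and V P p Q q E e f :: "nat \<Rightarrow> 'a"
  assumes x_nonzero: "x \<noteq> 0"
    and V_0: "V 0 = 0"
    and V_1: "V (Suc 0) = 1"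
    and V_Suc_Suc: "V (Suc (Suc j)) = V (Suc j) / x - V j"
    and P_0: "P 0 = 0"
    and P_Suc: "P (Suc j) = x + x * (P j * P (Suc j))"
    and p_0: "p 0 = x"
    and p_Suc: "p (Suc j) = x * (p j * P (Suc j) + P j * p (Suc j))"
    and Q_Suc: "Q (Suc j) = 1 + x * (P j * Q (Suc j))"
    and q_Suc: "q (Suc j) = x * (p j * Q (Suc j) + P j * q (Suc j))"
    and E_0: "E 0 = 1"
    and E_Suc: "E (Suc j) = 1 + x * (E j * P (Suc j))"
    and e_0: "e 0 = 0"
    and e_Suc: "e (Suc j) = x * (e j * P (Suc j) + E j * p (Suc j))"
    and f_Suc: "f (Suc j) = x * (e j * Q (Suc j) + E j * q (Suc j))"
begin

lemma P_Suc_times: "P (Suc j) * (1 - x * P j) = x"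
  using P_Suc[of j] by (simp add: algebra_simps)

lemma denominator_nonzero: "1 - x * P j \<noteq> 0"
  using P_Suc_times[of j] x_nonzero by auto

text \<open>The Chebyshev step reads \<open>V (Suc (Suc j)) = V (Suc j) * (1 - x * P j) / x\<close>,
  so nonvanishing needs the formula for \<open>P j\<close> and vice versa; hence the joint
  induction.\<close>

lemma V_nonzero_and_P_eq: "V (Suc j) \<noteq> 0 \<and> P j = V j / V (Suc j)"
proof (induction j)
  case 0
  then show ?case by (simp add: V_0 V_1 P_0)
next
  case (Suc j)
  have V: "V (Suc (Suc j)) = V (Suc j) * (1 - x * P j) / x"
    using Suc x_nonzero by (simp add: V_Suc_Suc field_simps)
  have "P (Suc j) = x / (1 - x * P j)"
    using P_Suc_times[of j] denominator_nonzero[of j] by (simp add: eq_divide_eq)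
  then show ?case
    using Suc V denominator_nonzero[of j] x_nonzero by simp
qed

lemma V_nonzero: "V (Suc j) \<noteq> 0"
  and P_eq: "P j = V j / V (Suc j)"
  using V_nonzero_and_P_eq by blast+

lemma p_eq: "p j = x / (V (Suc j))\<^sup>2"
proof (induction j)
  case 0
  then show ?case by (simp add: V_1 p_0)
next
  case (Suc j)
  have "p (Suc j) * (1 - x * P j) = x * p j * P (Suc j)"
    using p_Suc[of j] by (simp add: algebra_simps)
  \<comment> \<open>Multiplying by \<open>P (Suc j)\<close> turns the denominator into
    \<open>x\<close>, leaving the ratio \<open>(P (Suc j))\<^sup>2\<close>, which
    telescopes.\<close>
  then have "p (Suc j) * (P (Suc j) * (1 - x * P j)) = x * p j * (P (Suc j))\<^sup>2"
    by (simp add: power2_eq_square mult.assoc mult.left_commute)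
  then have "p (Suc j) = p j * (P (Suc j))\<^sup>2"
    using x_nonzero by (simp add: P_Suc_times)
  then show ?case
    using Suc V_nonzero[of j] by (simp add: P_eq power_divide)
qed

text \<open>\<open>x * Q (Suc j)\<close> and \<open>P (Suc j)\<close> solve the same linear equation
  with coefficient \<open>1 - x * P j\<close>.\<close>

lemma Q_eq: "Q (Suc j) = P (Suc j) / x"
proof -
  have "Q (Suc j) * (1 - x * P j) = 1"
    using Q_Suc[of j] by (simp add: algebra_simps)
  then have "x * Q (Suc j) * (1 - x * P j) = P (Suc j) * (1 - x * P j)"
    by (simp only: P_Suc_times mult.assoc mult_1_right)
  then have "x * Q (Suc j) = P (Suc j)"
    using denominator_nonzero[of j] by simp
  then show ?thesis using x_nonzero by (metis nonzero_mult_div_cancel_left)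
qed

lemma q_eq: "q (Suc j) = p (Suc j) / x"
proof -
  have "q (Suc j) * (1 - x * P j) = p j * (x * Q (Suc j))"
    using q_Suc[of j] by (simp add: algebra_simps)
  then have "x * q (Suc j) * (1 - x * P j) = x * (p j * P (Suc j))"
    using x_nonzero by (simp add: Q_eq mult.assoc)
  also have "\<dots> = p (Suc j) * (1 - x * P j)"
    using p_Suc[of j] by (simp add: algebra_simps)
  finally have "x * q (Suc j) = p (Suc j)"
    using denominator_nonzero[of j] by simp
  then show ?thesis using x_nonzero by (metis nonzero_mult_div_cancel_left)
qed

lemma E_eq: "E j = (x ^ Suc j + V j) / (x * V (Suc j))"
proof (induction j)
  case 0
  then show ?case using x_nonzero by (simp add: V_0 V_1 E_0)
next
  case (Suc j)
  have "E (Suc j) = 1 + x * (E j * (V (Suc j) / V (Suc (Suc j))))"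
    by (simp add: E_Suc[of j] P_eq)
  also have "\<dots> = (V (Suc (Suc j)) + V j + x ^ Suc j) / V (Suc (Suc j))"
    using Suc V_nonzero[of j] V_nonzero[of "Suc j"] x_nonzero
    by (simp add: field_simps)
  \<comment> \<open>The constant 1 in the recurrence supplied \<open>V (Suc (Suc j))\<close>, and
    the Chebyshev recursion collapses the sum.\<close>
  also have "V (Suc (Suc j)) + V j = V (Suc j) / x"
    by (simp add: V_Suc_Suc)
  also have "(V (Suc j) / x + x ^ Suc j) / V (Suc (Suc j)) =
      (x ^ Suc (Suc j) + V (Suc j)) / (x * V (Suc (Suc j)))"
    using V_nonzero[of "Suc j"] x_nonzero by (simp add: field_simps)
  finally show ?case .
qed

text \<open>The sum of the theorem for \<open>k = j + 1\<close>, with \<open>V m\<close> in the role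
  of \<open>U_{m-1}\<close>.\<close>

definition down_sum :: "nat \<Rightarrow> 'a" where
  "down_sum j = (\<Sum>m<j. x ^ (j - m) * (x ^ Suc m + V m) / (V (Suc m) * V (Suc (Suc m))))"

lemma down_sum_Suc:
  "down_sum (Suc j) = x * down_sum j + x * (x ^ Suc j + V j) / (V (Suc j) * V (Suc (Suc j)))"
proof -
  have "(\<Sum>m<j. x ^ (Suc j - m) * (x ^ Suc m + V m) / (V (Suc m) * V (Suc (Suc m)))) =
      x * down_sum j"
    unfolding down_sum_def sum_distrib_left
    by (rule sum.cong) (auto simp: Suc_diff_le mult.assoc)
  then show ?thesis by (simp add: down_sum_def)
qed

text \<open>After multiplication by \<open>V (Suc (Suc j))\<close>, the recurrence for
  \<open>e\<close> is exactly \<open>down_sum_Suc\<close>.\<close>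

lemma e_eq: "e j = down_sum j / V (Suc j)"
proof (induction j)
  case 0
  then show ?case by (simp add: e_0 down_sum_def)
next
  case (Suc j)
  have "e (Suc j) = x * (down_sum j / V (Suc j) * (V (Suc j) / V (Suc (Suc j)))
      + (x ^ Suc j + V j) / (x * V (Suc j)) * (x / (V (Suc (Suc j)))\<^sup>2))"
    by (simp only: e_Suc[of j] Suc E_eq[of j] P_eq[of "Suc j"] p_eq[of "Suc j"])
  also have "\<dots> = (x * down_sum j + x * (x ^ Suc j + V j) / (V (Suc j) * V (Suc (Suc j)))) /
      V (Suc (Suc j))"
  proof -
    \<comment> \<open>Here \<open>y\<close> stands for \<open>x ^ Suc j + V j\<close>, and
      \<open>v\<close>, \<open>w\<close> for two consecutive values of \<open>V\<close>.\<close>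
    have "x * (d / v * (v / w) + y / (x * v) * (x / w\<^sup>2)) = (x * d + x * y / (v * w)) / w"
      if "v \<noteq> 0" "w \<noteq> 0" for d v w y :: 'a
      using that x_nonzero by (simp add: field_simps power2_eq_square)
    then show ?thesis using V_nonzero by blast
  qed
  finally show ?case unfolding down_sum_Suc .
qed

text \<open>Replacing \<open>P\<close> and \<open>p\<close> by \<open>Q\<close> and \<open>q\<close>
  in the recurrence for \<open>e\<close> divides every term by \<open>x\<close>.\<close>

lemma f_eq: "f (Suc j) = e (Suc j) / x"
  using x_nonzero by (simp add: f_Suc[of j] e_Suc[of j] Q_eq q_eq field_simps)

end

section \<open>The recurrences for the Laurent series of the tree classes\<close>

abbreviation H :: "bool \<Rightarrow> bool \<Rightarrow> nat \<Rightarrow> nat \<Rightarrow> rat fls" where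
  "H b p c j \<equiv> fps_to_fls (G b p (Suc j) c)"

lemma H_exactly_one:
  "H b p 1 (Suc j) =
     fls_X * (H b b 1 j * H True (p = b) 0 (Suc j) + H b b 0 j * H True (p = b) 1 (Suc j))"
  by (subst G_exactly_one) (simp add: fls_times_fps_to_fls)

lemma H_avoiding:
  assumes "b \<or> \<not> p"
  shows "H b p 0 (Suc j) =
     (if p then fls_X else 1) + fls_X * (H b b 0 j * H True (p = b) 0 (Suc j))"
  by (subst G_avoiding[OF assms]) (simp add: fls_times_fps_to_fls)

text \<open>At \<open>1 / (2 * fls_X)\<close> the factor \<open>2t\<close> becomes
  \<open>1 / fls_X\<close>. The case \<open>n = 0\<close> is separate because it involves
  \<open>U_{-1} = 0\<close>, set by convention.\<close>

lemma Ux_recurrence: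
  "Ux (int (Suc (Suc n)) - 1) = Ux (int (Suc n) - 1) / fls_X - Ux (int n - 1)"
proof (cases n)
  case (Suc m)
  then show ?thesis
    by (simp add: Ux_def chebyshev_U_def nat_add_distrib)
qed (simp add: Ux_def chebyshev_U_def)

interpretation gf: avoider_recurrences fls_X "\<lambda>n. Ux (int n - 1)"
  "H True True 0" "H True True 1" "H True False 0" "H True False 1"
  "H False False 0" "H False False 1" "H False True 1"
proof
  show "Ux (int 0 - 1) = 0" "Ux (int (Suc 0) - 1) = 1"
    by (simp_all add: Ux_def chebyshev_U_def)
  fix j
  show "Ux (int (Suc (Suc j)) - 1) = Ux (int (Suc j) - 1) / fls_X - Ux (int j - 1)"
    by (rule Ux_recurrence)
  show "H True True 1 (Suc j) =
      fls_X * (H True True 1 j * H True True 0 (Suc j) + H True True 0 j * H True True 1 (Suc j))"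
    "H True False 1 (Suc j) =
      fls_X * (H True True 1 j * H True False 0 (Suc j) + H True True 0 j * H True False 1 (Suc j))"
    "H False False 1 (Suc j) =
      fls_X * (H False False 1 j * H True True 0 (Suc j) + H False False 0 j * H True True 1 (Suc j))"
    "H False True 1 (Suc j) =
      fls_X * (H False False 1 j * H True False 0 (Suc j) + H False False 0 j * H True False 1 (Suc j))"
    using H_exactly_one[of True True j] H_exactly_one[of True False j]
      H_exactly_one[of False False j] H_exactly_one[of False True j] by simp_all
  show "H True True 0 (Suc j) = fls_X + fls_X * (H True True 0 j * H True True 0 (Suc j))"
    "H True False 0 (Suc j) = 1 + fls_X * (H True True 0 j * H True False 0 (Suc j))"
    "H False False 0 (Suc j) = 1 + fls_X * (H False False 0 j * H True True 0 (Suc j))"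
    using H_avoiding[of True True j] H_avoiding[of True False j] H_avoiding[of False False j]
    by simp_all
qed (simp_all only: G_1 fps_zero_to_fls fps_one_to_fls fps_X_to_fls fls_X_nonzero not_False_eq_True)

theorem theorem3p1:
  fixes k :: nat
  assumes "k \<ge> 2"
  shows
    "gen_fun up_down k = fls_X / (Ux (int k - 1))\<^sup>2 \<and>
     gen_fun down_down k =
       1 / Ux (int k - 1) *
         (\<Sum>m = 0..k - 2. fls_X ^ (k - 1 - m) * (fls_X ^ (m + 1) + Ux (int m - 1)) /
                           (Ux (int m) * Ux (int m + 1))) \<and>
     gen_fun up_up k = 1 / (Ux (int k - 1))\<^sup>2 \<and>
     gen_fun down_up k =
       1 / (fls_X * Ux (int k - 1)) *
         (\<Sum>m = 0..k - 2. fls_X ^ (k - 1 - m) * (fls_X ^ (m + 1) + Ux (int m - 1)) /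
                           (Ux (int m) * Ux (int m + 1)))"
proof -
  \<comment> \<open>Pattern length \<open>k\<close> has sequence index \<open>Suc j = k - 1\<close>,
    where the formulas for \<open>Q\<close>, \<open>q\<close> and \<open>f\<close> apply.\<close>
  obtain j where k: "k = Suc (Suc j)"
    using assms by (metis Suc_le_D numeral_2_eq_2 Suc_le_mono)
  have ud: "gen_fun up_down k = H True True 1 (Suc j)"
    and uu: "gen_fun up_up k = H True False 1 (Suc j)"
    and dd: "gen_fun down_down k = H False False 1 (Suc j)"
    and du: "gen_fun down_up k = H False True 1 (Suc j)"
    unfolding k[symmetric]
    by (rule gen_fun_eq_G[OF assms];
      simp add: up_down_def up_up_def down_down_def down_up_def
        alternating_from_up_iff alternating_from_down_iff)+
  have sum: "(\<Sum>m = 0..k - 2. fls_X ^ (k - 1 - m) * (fls_X ^ (m + 1) + Ux (int m - 1)) /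
                           (Ux (int m) * Ux (int m + 1))) = gf.down_sum (Suc j)"
    unfolding gf.down_sum_def
    by (rule sum.cong) (auto simp: k add.commute)
  show ?thesis
    unfolding sum ud uu dd du unfolding gf.q_eq gf.f_eq gf.p_eq gf.e_eq k
    \<comment> \<open>Quotients by \<open>fls_X\<close> have to stay in the form used by the
      statement.\<close>
    by (simp del: fls_divide_X)
qed

end
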